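(* Let $\mathbf{a}$ be a non-empty composition with binary word $\varepsilon_1\cdots\varepsilon_k$. For all $y\in\,]-\frac{\pi}{2},\frac{\pi}{2}[$ we have $$\sigma_{\mathbf{a}}(4\sin^2y)=2^k(\tan y)^{\varepsilon_1}\,\mathrm{It}\!\int_0^y\big((\tan t)^{\varepsilon_1+\varepsilon_2-1}dt,\ldots,(\tan t)^{\varepsilon_{k-1}+\varepsilon_k-1}dt,\;dt\big),$$ and more generally, for every integer $n\geqslant0$, $$\sigma_{\mathbf{a}}(4\sin^2y)_n=2^k\binom{2n}{n}^{-1}(\tan y)^{\varepsilon_1}\,\mathrm{It}\!\int_0^y\big((\tan t)^{\varepsilon_1+\varepsilon_2-1}dt,\ldots,(\tan t)^{\varepsilon_{k-1}+\varepsilon_k-1}dt,\;(4\sin^2t)^ndt\big).$$ When $\mathbf{a}$ is admissible, these formulas remain valid for $y\in[-\frac{\pi}{2},\frac{\pi}{2}]$.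
   Context: A composition is a finite sequence $\mathbf{a}=(a_1,\ldots,a_r)$ of positive integers; it is admissible if $a_1\geqslant2$ (or it is empty). Its binary word is $0^{a_1-1}1\,0^{a_2-1}1\cdots0^{a_r-1}1$ ($0^u$ = $u$ zeros), of length $k=a_1+\cdots+a_r$. For non-empty $\mathbf{a}$ and $n\geqslant0$: $\sigma_{\mathbf{a}}(z)=\sum_{n_1>\cdots>n_r>0}\binom{2n_1}{n_1}^{-1}n_1^{-a_1}\cdots n_r^{-a_r}z^{n_1}$ and $\sigma_{\mathbf{a}}(z)_n=\sum_{n_1>\cdots>n_r>n}\binom{2n_1}{n_1}^{-1}n_1^{-a_1}\cdots n_r^{-a_r}z^{n_1}$ (convergent for $|z|<4$, and for $|z|\leqslant4$ when $\mathbf{a}$ is admissible). Iterated integrals are defined recursively: $\mathrm{It}\int_0^y(g_1dt)=\int_0^yg_1(t)\,dt$ and $\mathrm{It}\int_0^y(g_1dt,\ldots,g_mdt)=\int_0^yg_1(t)\,\mathrm{It}\int_0^t(g_2dt,\ldots,g_mdt)\,dt$. When $k=1$ the list of forms consists only of the last one. *)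

theory Defs
  imports "HOL-Analysis.Analysis"
begin

definition composition :: "nat list \<Rightarrow> bool" where
  "composition a \<longleftrightarrow> (\<forall>x\<in>set a. 0 < x)"

definition admissible :: "nat list \<Rightarrow> bool" where
  "admissible a \<longleftrightarrow> composition a \<and> (a = [] \<or> 2 \<le> hd a)"

definition binary_word :: "nat list \<Rightarrow> nat list" where
  "binary_word a = concat (map (\<lambda>x. replicate (x - 1) 0 @ [1]) a)"

definition decreasing_tuples :: "nat \<Rightarrow> nat \<Rightarrow> nat list set" where
  "decreasing_tuples r n = {ns. length ns = r \<and> sorted_wrt (>) ns \<and> (\<forall>m\<in>set ns. n < m)}"

definition sigma_term :: "nat list \<Rightarrow> real \<Rightarrow> nat list \<Rightarrow> real" where
  "sigma_term a z ns =
     inverse (real ((2 * hd ns) choose hd ns)) *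
     (\<Prod>i<length a. inverse (real (ns ! i) ^ (a ! i))) * z ^ hd ns"

text \<open>The sums are only meaningful for non-empty \<open>a\<close>, and are sums of absolutely summable
  families for \<open>\<bar>z\<bar> < 4\<close>, or for \<open>\<bar>z\<bar> \<le> 4\<close> when \<open>a\<close> is admissible.\<close>

definition sigma_series :: "nat list \<Rightarrow> real \<Rightarrow> real" where
  "sigma_series a z = (\<Sum>\<^sub>\<infinity>ns\<in>decreasing_tuples (length a) 0. sigma_term a z ns)"

definition sigma_tail :: "nat list \<Rightarrow> real \<Rightarrow> nat \<Rightarrow> real" where
  "sigma_tail a z n = (\<Sum>\<^sub>\<infinity>ns\<in>decreasing_tuples (length a) n. sigma_term a z ns)"

text \<open>The integral is the oriented one, so \<open>y < 0\<close> is allowed. The value \<open>1\<close> on the empty list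
  makes the one-form case the plain integral of that form.\<close>

primrec iterated_integral :: "(real \<Rightarrow> real) list \<Rightarrow> real \<Rightarrow> real" where
  "iterated_integral [] y = 1"
| "iterated_integral (g # gs) y = (LBINT t=0..ereal y. g t * iterated_integral gs t)"

text \<open>The exponents range over \<open>{-1, 0, 1}\<close>, hence the integer power; its value at \<open>t = 0\<close> for
  exponent \<open>-1\<close> is irrelevant to the integrals.\<close>

definition tan_forms :: "nat list \<Rightarrow> (real \<Rightarrow> real) \<Rightarrow> (real \<Rightarrow> real) list" where
  "tan_forms w g =
     map (\<lambda>i t. tan t powi (int (w ! i) + int (w ! Suc i) - 1)) [0..<length w - 1] @ [g]"

end

theory Submission
  imports Defs
begin

text \<open>
  Put \<open>u\<^sub>N(t) = (4 sin\<^sup>2 t)\<^sup>N / binom(2N, N)\<close>. Prefixing a letter to a word acts on the iterated integral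
  by \<open>f \<mapsto> 2 \<integral>\<^sub>0\<^sup>y cot t f(t) dt\<close> (letter \<open>0\<close>) or \<open>f \<mapsto> 2 tan y \<integral>\<^sub>0\<^sup>y f(t) dt\<close> (letter \<open>1\<close>), since the factor
  \<open>(tan t)\<^sup>\<epsilon>\<close> of the shorter word is absorbed into the next form. The first operator sends \<open>u\<^sub>m\<close> to
  \<open>u\<^sub>m / m\<close>. By the reduction formula for the integral of \<open>sin\<^sup>2\<^sup>N\<close>, which telescopes because
  \<open>u\<^sub>N(y) \<rightarrow> 0\<close> for \<open>\<bar>y\<bar> < \<pi>/2\<close>, the second sends \<open>u\<^sub>m\<close> to \<open>\<Sum>\<^sub>N\<^sub>>\<^sub>m u\<^sub>N / N\<close>. Starting from \<open>u\<^sub>n\<close>, the binary word of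
  \<open>a\<close> thus produces exactly the nested sum. All terms are nonnegative for \<open>y \<ge> 0\<close>, so monotone
  convergence justifies each interchange, including at \<open>y = \<pi>/2\<close> when the first letter is \<open>0\<close>;
  negative \<open>y\<close> follows by parity.
\<close>

section \<open>Central binomial coefficients and the monomials u_N\<close>

definition central_ratio :: "nat \<Rightarrow> real" where
  "central_ratio N = 4 ^ N / real ((2 * N) choose N)"

text \<open>This is u_N of the overview, with 4^N moved into the constant so that only a power of
  the sine depends on \<open>t\<close>.\<close>

definition sin_monomial :: "nat \<Rightarrow> real \<Rightarrow> real" where
  "sin_monomial N t = central_ratio N * sin t ^ (2 * N)"

text \<open>The coefficients of \<open>\<sigma>\<^sub>a(4 sin\<^sup>2 t)\<^sub>n\<close> in terms of \<open>sin_monomial\<close>, for \<open>w\<close> the binary word of \<open>a\<close>.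
  The empty word stands for the single monomial of degree \<open>n\<close>. At \<open>N = 0\<close> the division by zero
  yields the correct coefficient \<open>0\<close>.\<close>

primrec word_coeff :: "nat \<Rightarrow> nat list \<Rightarrow> nat \<Rightarrow> real" where
  "word_coeff n [] N = (if N = n then 1 else 0)"
| "word_coeff n (e # w) N =
     (if e = 0 then word_coeff n w N else (\<Sum>m<N. word_coeff n w m)) / real N"

lemma central_ratio_pos: "central_ratio N > 0"
  by (simp add: central_ratio_def)

lemma central_binomial_Suc:
  "Suc N * ((2 * Suc N) choose Suc N) = 2 * (2 * N + 1) * ((2 * N) choose N)"
proof -
  \<comment> \<open>The extra factor \<open>Suc N\<close> allows the absorption identity to be
    applied twice; it is cancelled at the end.\<close>
  have "Suc N * (Suc N * ((2 * Suc N) choose Suc N)) = Suc N * (2 * Suc N * (Suc (2 * N) choose N))"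
    using Suc_times_binomial[of N "Suc (2 * N)"] by (simp only: mult_Suc_right add_2_eq_Suc)
  also have "Suc (2 * N) choose N = Suc (2 * N) choose Suc N"
    by (subst binomial_symmetric) auto
  also have "Suc N * (2 * Suc N * (Suc (2 * N) choose Suc N)) =
      2 * Suc N * (Suc N * (Suc (2 * N) choose Suc N))" by (simp only: mult_ac)
  also have "Suc N * (Suc (2 * N) choose Suc N) = Suc (2 * N) * ((2 * N) choose N)"
    by (rule Suc_times_binomial)
  finally have "Suc N * (Suc N * ((2 * Suc N) choose Suc N))
      = Suc N * (2 * (2 * N + 1) * ((2 * N) choose N))"
    by (simp only: mult_ac Suc_eq_plus1)
  then show ?thesis using mult_left_cancel by blast
qed

text \<open>The quotient (2N+2)/(2N+1) is Wallis' factor, here free of division. It is what matches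
  the constants of two consecutive monomials in the reduction formula.\<close>

lemma central_ratio_Suc:
  "central_ratio (Suc N) * (2 * real N + 1) = central_ratio N * (2 * real N + 2)"
proof -
  have "real (Suc N * ((2 * Suc N) choose Suc N)) = real (2 * (2 * N + 1) * ((2 * N) choose N))"
    by (simp only: central_binomial_Suc)
  then have *: "(1 + real N) * real ((2 * Suc N) choose Suc N) = (4 * real N + 2) * real ((2 * N) choose N)"
    by (simp only: of_nat_mult of_nat_Suc of_nat_add) (simp add: algebra_simps)
  define A B where "A = real ((2 * Suc N) choose Suc N)" and "B = real ((2 * N) choose N)"
  have "A > 0" "B > 0"
    unfolding A_def B_def by (simp_all del: mult_Suc_right binomial_Suc_Suc)
  moreover have "(2 * real N + 1) * B * 2 = (1 + real N) * A"
    using * unfolding A_def B_def by (simp add: algebra_simps)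
  ultimately have "4 * 4 ^ N / A * (2 * real N + 1) = 4 ^ N / B * (2 * real N + 2)"
    by (simp add: divide_simps) (simp add: algebra_simps)
  then show ?thesis
    unfolding central_ratio_def A_def B_def by (simp only: power_Suc)
qed

text \<open>Linear growth suffices for convergence below pi/2. The shift to \<open>Suc N\<close>
  covers N = 0 and produces the terms of the differentiated geometric series.\<close>

lemma central_ratio_le: "central_ratio N \<le> 2 * real (Suc N)"
proof (cases "N = 0")
  case False
  then have "4 ^ N / (2 * real N) \<le> real ((2 * N) choose N)"
    by (intro central_binomial_lower_bound) simp
  then have "central_ratio N \<le> 2 * real N"
    using False by (simp add: central_ratio_def field_simps)
  then show ?thesis by simp
qed (simp add: central_ratio_def)

lemma sin_monomial_eq:
  "sin_monomial N t = inverse (real ((2 * N) choose N)) * (4 * (sin t)\<^sup>2) ^ N"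
  by (simp add: sin_monomial_def central_ratio_def power_mult_distrib divide_inverse mult_ac flip: power_mult)

lemma sin_monomial_nonneg: "sin_monomial N t \<ge> 0"
  using central_ratio_pos[of N] by (simp add: sin_monomial_def power_mult)

lemma sin_monomial_measurable [measurable]: "sin_monomial N \<in> borel_measurable borel"
  unfolding sin_monomial_def by measurable

lemma sin_monomial_le:
  "sin_monomial N t \<le> 2 * (real (Suc N) * ((sin t)\<^sup>2) ^ N)"
proof -
  have "central_ratio N * ((sin t)\<^sup>2) ^ N \<le> 2 * real (Suc N) * ((sin t)\<^sup>2) ^ N"
    by (intro mult_right_mono central_ratio_le) simp
  then show ?thesis
    unfolding sin_monomial_def power_mult by (simp only: mult.assoc)
qed

lemma sin_squared_less_1:
  fixes t :: real
  assumes "\<bar>t\<bar> < pi / 2"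
  shows "(sin t)\<^sup>2 < 1"
proof -
  have "cos t > 0" using assms by (intro cos_gt_zero_pi) auto
  then have "(cos t)\<^sup>2 > 0" by simp
  then show ?thesis using sin_cos_squared_add[of t] by linarith
qed

lemma summable_sin_monomial:
  assumes "\<bar>t\<bar> < pi / 2"
  shows "summable (\<lambda>N. sin_monomial N t)"
proof (rule summable_comparison_test')
  have "norm ((sin t)\<^sup>2) < 1" using sin_squared_less_1[OF assms] by simp
  from sums_summable[OF geometric_deriv_sums[OF this]]
  show "summable (\<lambda>N. 2 * (real (Suc N) * ((sin t)\<^sup>2) ^ N))"
    by (intro summable_mult)
  show "norm (sin_monomial N t) \<le> 2 * (real (Suc N) * ((sin t)\<^sup>2) ^ N)" for N
    using sin_monomial_le[of N t] sin_monomial_nonneg[of N t] by simp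
qed

text \<open>The letter 1 preserves the upper bound because it takes the sum of N earlier
  coefficients and divides it by N. Boundedness reduces every convergence question below pi/2 to the
  series of the monomials.\<close>

lemma word_coeff_bounds: "0 \<le> word_coeff n w N \<and> word_coeff n w N \<le> 1"
proof (induction w arbitrary: N)
  case (Cons e w)
  have "(\<Sum>m<N. word_coeff n w m) \<le> (\<Sum>m<N. 1)"
    using Cons.IH by (intro sum_mono) auto
  moreover have "(\<Sum>m<N. word_coeff n w m) \<ge> 0"
    using Cons.IH by (intro sum_nonneg) auto
  moreover have "word_coeff n w N / real N \<le> 1"
  proof (cases "N = 0")
    case False
    then have "word_coeff n w N \<le> real N" using Cons.IH[of N] by linarith
    with False show ?thesis by simp
  qed simp
  ultimately show ?case using Cons.IH[of N]
    by (cases "N = 0") (auto simp: field_simps)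
qed simp

lemma word_coeff_nonneg: "0 \<le> word_coeff n w N"
  using word_coeff_bounds by blast

lemma word_coeff_zero: "w \<noteq> [] \<Longrightarrow> word_coeff n w 0 = 0"
  by (cases w) auto

lemma summable_word_coeff:
  assumes "\<bar>t\<bar> < pi / 2"
  shows "summable (\<lambda>N. word_coeff n w N * sin_monomial N t)"
proof (rule summable_comparison_test')
  show "summable (\<lambda>N. sin_monomial N t)" by (rule summable_sin_monomial[OF assms])
  show "norm (word_coeff n w N * sin_monomial N t) \<le> sin_monomial N t" for N
    using word_coeff_bounds[of n w N] sin_monomial_nonneg[of N t]
    by (simp add: abs_mult mult_left_le_one_le)
qed

section \<open>The two letters acting on a single monomial\<close>

text \<open>The derivative of sin^(2m) is 2m cot sin^(2m). For m = 0 and y > 0 the integral would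
  diverge at 0.\<close>

lemma nn_integral_cot_sin_monomial:
  assumes "m \<noteq> 0" "0 \<le> y" "y \<le> pi / 2"
  shows "(\<integral>\<^sup>+t. ennreal (2 * (tan t powi -1 * sin_monomial m t)) * indicator {0<..<y} t \<partial>lborel)
    = ennreal (sin_monomial m y / real m)"
proof (rule nn_integral_has_integral_lebesgue')
  obtain k where m: "m = Suc k" using assms(1) by (cases m) auto
  show "0 \<le> 2 * (tan t powi -1 * sin_monomial m t)" if "t \<in> {0<..<y}" for t
    using that assms tan_gt_zero[of t] sin_monomial_nonneg[of m t] by (simp add: power_int_minus)
  \<comment> \<open>Written without the tangent, the integrand is smooth on the closed interval,
    endpoints 0 and pi/2 included; it is compared with the cotangent form only on the open
    interval.\<close>
  have D: "((\<lambda>t. sin_monomial m t / real m) has_vector_derivative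
        2 * (central_ratio m * sin t ^ (2 * k + 1) * cos t)) (at t within {0..y})" for t
  proof -
    have "((\<lambda>t. sin t ^ (2 * m)) has_real_derivative real (2 * m) * (cos t * sin t ^ (2 * k + 1)))
        (at t within {0..y})"
      by (rule derivative_eq_intros refl)+ (simp add: m)
    from DERIV_cmult[OF this, of "central_ratio m / real m"] show ?thesis
      using assms(1) unfolding has_real_derivative_iff_has_vector_derivative[symmetric]
      by (simp add: sin_monomial_def mult_ac)
  qed
  have "((\<lambda>t. 2 * (central_ratio m * sin t ^ (2 * k + 1) * cos t)) has_integral
     (sin_monomial m y / real m - sin_monomial m 0 / real m)) {0..y}"
    using assms D by (intro fundamental_theorem_of_calculus) auto
  then have "((\<lambda>t. 2 * (central_ratio m * sin t ^ (2 * k + 1) * cos t)) has_integral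
     (sin_monomial m y / real m)) {0<..<y}"
    by (simp add: has_integral_Icc_iff_Ioo sin_monomial_def m)
  then show "((\<lambda>t. 2 * (tan t powi -1 * sin_monomial m t)) has_integral
     (sin_monomial m y / real m)) {0<..<y}"
  proof (rule has_integral_eq[rotated])
    fix t assume t: "t \<in> {0<..<y}"
    then have "cos t > 0" "sin t > 0" using assms by (auto intro!: cos_gt_zero_pi sin_gt_zero)
    then show "2 * (central_ratio m * sin t ^ (2 * k + 1) * cos t) =
        2 * (tan t powi -1 * sin_monomial m t)"
      by (simp add: sin_monomial_def m tan_def power_int_minus field_simps)
  qed
qed

text \<open>The reduction formula behind Wallis' integrals; the normalisation by \<open>central_ratio\<close>
  makes it telescope.\<close>

lemma has_integral_sin_monomial_diff:
  assumes "0 \<le> y"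
  shows "((\<lambda>t. sin_monomial m t - sin_monomial (Suc m) t) has_integral
     (central_ratio (Suc m) / (2 * real (Suc m)) * (sin y ^ (2 * m + 1) * cos y))) {0..y}"
proof -
  let ?c = "central_ratio (Suc m) / (2 * real (Suc m))"
  have c: "?c * (2 * real m + 1) = central_ratio m" "?c * (2 * real m + 2) = central_ratio (Suc m)"
    using central_ratio_Suc[of m] by (simp_all add: field_simps)
  have D: "((\<lambda>t. ?c * (sin t ^ (2 * m + 1) * cos t)) has_vector_derivative
      sin_monomial m t - sin_monomial (Suc m) t) (at t within {0..y})" for t
  proof -
    have "((\<lambda>t. sin t ^ (2 * m + 1) * cos t) has_real_derivative
       (2 * real m + 1) * sin t ^ (2 * m) * (cos t)\<^sup>2 - sin t ^ (2 * m) * (sin t)\<^sup>2) (at t within {0..y})"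
      by (rule derivative_eq_intros refl | simp)+ (simp add: power2_eq_square algebra_simps)
    then have "((\<lambda>t. ?c * (sin t ^ (2 * m + 1) * cos t)) has_real_derivative
       ?c * ((2 * real m + 1) * sin t ^ (2 * m) * (cos t)\<^sup>2 - sin t ^ (2 * m) * (sin t)\<^sup>2)) (at t within {0..y})"
      by (rule DERIV_cmult)
    also have "?c * ((2 * real m + 1) * sin t ^ (2 * m) * (cos t)\<^sup>2 - sin t ^ (2 * m) * (sin t)\<^sup>2)
      = ?c * (2 * real m + 1) * sin t ^ (2 * m) - ?c * (2 * real m + 2) * (sin t ^ (2 * m) * (sin t)\<^sup>2)"
      unfolding cos_squared_eq by (simp only: algebra_simps) (simp add: algebra_simps)
    also have "\<dots> = sin_monomial m t - sin_monomial (Suc m) t"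
      by (subst c)+ (simp add: sin_monomial_def power2_eq_square)
    finally show ?thesis by (simp only: has_real_derivative_iff_has_vector_derivative)
  qed
  show ?thesis
    using fundamental_theorem_of_calculus[OF assms D] by simp
qed

lemma sin_monomial_integrable: "sin_monomial m integrable_on {a..b}"
  unfolding sin_monomial_def by (intro integrable_continuous_real continuous_intros)

lemma sums_sin_monomial_integral:
  assumes "0 \<le> y" "y < pi / 2"
  shows "(\<lambda>N. if m < N then sin_monomial N y / real N else 0) sums
    (2 * tan y * integral {0..y} (sin_monomial m))"
proof -
  define J where "J N = integral {0..y} (sin_monomial N)" for N
  \<comment> \<open>On [0, y] the monomials are increasing, so J N is at most y times the value at
    y, which is a term of a convergent series.\<close>
  have lim: "J \<longlonglongrightarrow> 0"
  proof (rule tendsto_sandwich)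
    show "\<forall>\<^sub>F N in sequentially. 0 \<le> J N"
      unfolding J_def by (intro always_eventually allI integral_nonneg sin_monomial_integrable sin_monomial_nonneg)
    have "sin_monomial N t \<le> sin_monomial N y" if "t \<in> {0..y}" for N t
    proof -
      have "0 \<le> sin t" using that assms by (intro sin_ge_zero) auto
      moreover have "sin t \<le> sin y" using that assms by (intro sin_monotone_2pi_le) auto
      ultimately show ?thesis unfolding sin_monomial_def
        using central_ratio_pos[of N] by (intro mult_left_mono power_mono) auto
    qed
    then have "J N \<le> integral {0..y} (\<lambda>_. sin_monomial N y)" for N
      unfolding J_def by (intro integral_le sin_monomial_integrable) auto
    then show "\<forall>\<^sub>F N in sequentially. J N \<le> y * sin_monomial N y"
      using assms by (intro always_eventually allI) simp
    have "(\<lambda>N. sin_monomial N y) \<longlonglongrightarrow> 0"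
      using assms by (intro summable_LIMSEQ_zero summable_sin_monomial) auto
    then show "(\<lambda>N. y * sin_monomial N y) \<longlonglongrightarrow> 0" by (rule tendsto_mult_right_zero)
  qed simp
  \<comment> \<open>In the reduction formula, the factor tan y cancels cos y and raises the odd
    power of the sine to the even power 2(N+1).\<close>
  have step: "2 * tan y * (J N - J (Suc N)) = sin_monomial (Suc N) y / real (Suc N)" for N
  proof -
    have "J N - J (Suc N) = integral {0..y} (\<lambda>t. sin_monomial N t - sin_monomial (Suc N) t)"
      unfolding J_def by (intro integral_diff[symmetric] sin_monomial_integrable)
    also have "\<dots> = central_ratio (Suc N) / (2 * real (Suc N)) * (sin y ^ (2 * N + 1) * cos y)"
      using has_integral_sin_monomial_diff[OF assms(1)] by (rule integral_unique)
    finally have J: "J N - J (Suc N) = \<dots>" .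
    have "cos y \<noteq> 0" using assms cos_gt_zero_pi[of y] by simp
    then show ?thesis unfolding J by (simp add: sin_monomial_def tan_def field_simps)
  qed
  have "(\<lambda>i. J (i + m)) \<longlonglongrightarrow> 0" using lim by (rule LIMSEQ_ignore_initial_segment)
  from sums_mult[OF telescope_sums'[OF this], of "2 * tan y"]
  have "(\<lambda>i. sin_monomial (i + Suc m) y / real (i + Suc m)) sums (2 * tan y * J m)"
    using step by simp
  \<comment> \<open>Telescoping from J m first yields the term of index m + 1; the terms of index at
    most m are 0, so undoing the shift adds nothing.\<close>
  then have "(\<lambda>i. (\<lambda>N. if m < N then sin_monomial N y / real N else 0) (i + Suc m)) sums (2 * tan y * J m)"
    by simp
  then show ?thesis
    unfolding J_def by (subst (asm) sums_iff_shift) simp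
qed

lemma nn_integral_sin_monomial:
  assumes "0 \<le> y" "y < pi / 2"
  shows "ennreal (2 * tan y) * (\<integral>\<^sup>+t. ennreal (sin_monomial m t) * indicator {0<..<y} t \<partial>lborel)
    = (\<Sum>N. ennreal (if m < N then sin_monomial N y / real N else 0))"
proof -
  have "(sin_monomial m has_integral integral {0..y} (sin_monomial m)) {0<..<y}"
    using integrable_integral[OF sin_monomial_integrable, of m 0 y]
    by (simp add: has_integral_Icc_iff_Ioo)
  then have "(\<integral>\<^sup>+t. ennreal (sin_monomial m t) * indicator {0<..<y} t \<partial>lborel)
    = ennreal (integral {0..y} (sin_monomial m))"
    by (intro nn_integral_has_integral_lebesgue' sin_monomial_nonneg)
  moreover have "tan y \<ge> 0" using assms tan_gt_zero[of y] by (cases "y = 0") auto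
  moreover have "integral {0..y} (sin_monomial m) \<ge> 0"
    by (intro integral_nonneg sin_monomial_integrable sin_monomial_nonneg)
  moreover have "(\<Sum>N. ennreal (if m < N then sin_monomial N y / real N else 0)) =
      ennreal (2 * tan y * integral {0..y} (sin_monomial m))"
    using sin_monomial_nonneg by (intro suminf_ennreal_eq sums_sin_monomial_integral assms) auto
  ultimately show ?thesis by (simp add: ennreal_mult)
qed

section \<open>Termwise integration of word series\<close>

text \<open>One of the two sums is read as an integral over the counting measure, which commutes
  with countable sums of nonnegative functions.\<close>

lemma suminf_ennreal_swap:
  fixes f :: "nat \<Rightarrow> nat \<Rightarrow> ennreal"
  shows "(\<Sum>i. \<Sum>j. f i j) = (\<Sum>j. \<Sum>i. f i j)"
  using nn_integral_suminf[of "\<lambda>j i. f i j" "count_space UNIV"]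
  by (simp add: nn_integral_count_space_nat)

text \<open>For a nonnegative integrand the Bochner integral is \<open>enn2real\<close> of the
  nonnegative one, and both give 0 in the divergent case. Interchange with the sum then takes place
  in \<open>ennreal\<close>.\<close>

lemma LBINT_word_series:
  fixes h H :: "real \<Rightarrow> real"
  assumes [measurable]: "h \<in> borel_measurable borel"
    and h: "\<And>t. 0 < t \<Longrightarrow> t < y \<Longrightarrow> h t \<ge> 0"
    and H: "\<And>t. 0 < t \<Longrightarrow> t < y \<Longrightarrow> H t = (\<Sum>N. word_coeff n w N * sin_monomial N t)"
    and y: "0 \<le> y" "y \<le> pi / 2"
  shows "(LBINT t=0..ereal y. h t * H t) =
    enn2real (\<Sum>N. ennreal (word_coeff n w N) *
       (\<integral>\<^sup>+t. ennreal (h t * sin_monomial N t) * indicator {0<..<y} t \<partial>lborel))"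
proof -
  let ?F = "\<lambda>t. indicator {0<..<y} t * (h t * (\<Sum>N. word_coeff n w N * sin_monomial N t))"
  have "einterval 0 (ereal y) = {0<..<y}" by (auto simp: einterval_def zero_ereal_def)
  then have "(LBINT t=0..ereal y. h t * H t) = (\<integral>t. indicator {0<..<y} t * (h t * H t) \<partial>lborel)"
    using y by (simp add: interval_lebesgue_integral_le_eq set_lebesgue_integral_def)
  \<comment> \<open>\<open>H\<close> is arbitrary outside the interval; measurability is established
    for the series that replaces it.\<close>
  also have "\<dots> = (\<integral>t. ?F t \<partial>lborel)"
    using H by (intro Bochner_Integration.integral_cong) (auto simp: indicator_def)
  also have "\<dots> = enn2real (\<integral>\<^sup>+t. ennreal (?F t) \<partial>lborel)"
  proof (rule integral_eq_nn_integral)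
    show "AE t in lborel. 0 \<le> ?F t"
    proof (intro AE_I2)
      fix t
      have "0 \<le> (\<Sum>N. word_coeff n w N * sin_monomial N t)" if "t \<in> {0<..<y}"
        using that y
        by (intro suminf_nonneg summable_word_coeff mult_nonneg_nonneg word_coeff_nonneg sin_monomial_nonneg) auto
      then show "0 \<le> ?F t" using h by (auto simp: indicator_def)
    qed
  qed measurable
  also have "(\<integral>\<^sup>+t. ennreal (?F t) \<partial>lborel) = (\<integral>\<^sup>+t. (\<Sum>N. ennreal (word_coeff n w N) *
      (ennreal (h t * sin_monomial N t) * indicator {0<..<y} t)) \<partial>lborel)"
  proof (rule nn_integral_cong)
    fix t
    show "ennreal (?F t) = (\<Sum>N. ennreal (word_coeff n w N) *
      (ennreal (h t * sin_monomial N t) * indicator {0<..<y} t))"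
    proof (cases "t \<in> {0<..<y}")
      case True
      have "(\<Sum>N. ennreal (word_coeff n w N) * ennreal (h t * sin_monomial N t)) =
         (\<Sum>N. ennreal (h t) * ennreal (word_coeff n w N * sin_monomial N t))"
        using True h word_coeff_nonneg sin_monomial_nonneg
        by (simp add: ennreal_mult[symmetric] mult_ac)
      also have "\<dots> = ennreal (h t) * ennreal (\<Sum>N. word_coeff n w N * sin_monomial N t)"
        using True y word_coeff_nonneg sin_monomial_nonneg
        by (subst ennreal_suminf_cmult, subst suminf_ennreal2) (auto intro!: summable_word_coeff)
      also have "\<dots> = ennreal (h t * (\<Sum>N. word_coeff n w N * sin_monomial N t))"
        using True h by (intro ennreal_mult'[symmetric]) auto
      finally show ?thesis using True by simp
    qed simp
  qed
  also have "\<dots> = (\<Sum>N. \<integral>\<^sup>+t. ennreal (word_coeff n w N) *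
      (ennreal (h t * sin_monomial N t) * indicator {0<..<y} t) \<partial>lborel)"
    by (intro nn_integral_suminf) measurable
  also have "\<dots> = (\<Sum>N. ennreal (word_coeff n w N) *
       (\<integral>\<^sup>+t. ennreal (h t * sin_monomial N t) * indicator {0<..<y} t \<partial>lborel))"
    by (intro arg_cong[where f = suminf] ext nn_integral_cmult) measurable
  finally show ?thesis .
qed

text \<open>The value y = pi/2 is allowed: \<open>H\<close> enters only strictly below
  \<open>y\<close>, and no factor tan y appears.\<close>

lemma word_series_Cons_0:
  assumes "w \<noteq> []" "0 \<le> y" "y \<le> pi / 2"
    and H: "\<And>t. 0 < t \<Longrightarrow> t < y \<Longrightarrow> H t = (\<Sum>N. word_coeff n w N * sin_monomial N t)"
  shows "2 * (LBINT t=0..ereal y. tan t powi -1 * H t) =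
    enn2real (\<Sum>N. ennreal (word_coeff n (0 # w) N * sin_monomial N y))"
proof -
  have "2 * (LBINT t=0..ereal y. tan t powi -1 * H t) =
      (LBINT t=0..ereal y. (2 * tan t powi -1) * H t)"
    by (simp only: interval_lebesgue_integral_mult_right mult.assoc)
  also have "\<dots> = enn2real (\<Sum>N. ennreal (word_coeff n w N) *
       (\<integral>\<^sup>+t. ennreal (2 * tan t powi -1 * sin_monomial N t) * indicator {0<..<y} t \<partial>lborel))"
  proof (rule LBINT_word_series[OF _ _ H])
    show "(\<lambda>t::real. 2 * tan t powi -1) \<in> borel_measurable borel"
      unfolding tan_def by (simp add: power_int_minus)
    show "0 \<le> 2 * tan t powi -1" if "0 < t" "t < y" for t
      using that assms tan_gt_zero[of t] by (simp add: power_int_minus)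
  qed (use assms in auto)
  also have "(\<lambda>N. ennreal (word_coeff n w N) *
       (\<integral>\<^sup>+t. ennreal (2 * tan t powi -1 * sin_monomial N t) * indicator {0<..<y} t \<partial>lborel)) =
     (\<lambda>N. ennreal (word_coeff n (0 # w) N * sin_monomial N y))"
  proof
    fix N
    show "ennreal (word_coeff n w N) *
       (\<integral>\<^sup>+t. ennreal (2 * tan t powi -1 * sin_monomial N t) * indicator {0<..<y} t \<partial>lborel) =
       ennreal (word_coeff n (0 # w) N * sin_monomial N y)"
    \<comment> \<open>The integral of the cotangent may be infinite for N = 0, but its coefficient
      is 0 since \<open>w\<close> is non-empty, and 0 times infinity is 0 in
      \<open>ennreal\<close>.\<close>
    proof (cases "N = 0")
      case True
      then show ?thesis using word_coeff_zero[OF assms(1)] by simp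
    next
      case False
      then show ?thesis
        using nn_integral_cot_sin_monomial[OF False assms(2,3)] word_coeff_nonneg[of n w N]
          sin_monomial_nonneg[of N y]
        by (simp add: mult.assoc ennreal_mult[symmetric])
    qed
  qed
  finally show ?thesis .
qed

text \<open>Each monomial of degree m becomes a sum over N > m. Exchanging the summations collects,
  for fixed N, the coefficients with m < N, as in the recursion for
  \<open>word_coeff\<close>.\<close>

lemma word_series_Cons_1:
  assumes "0 \<le> y" "y < pi / 2"
    and H: "\<And>t. 0 < t \<Longrightarrow> t < y \<Longrightarrow> H t = (\<Sum>N. word_coeff n w N * sin_monomial N t)"
  shows "2 * tan y * (LBINT t=0..ereal y. H t) =
    enn2real (\<Sum>N. ennreal (word_coeff n (1 # w) N * sin_monomial N y))"
proof -
  let ?I = "\<lambda>N. \<integral>\<^sup>+t. ennreal (sin_monomial N t) * indicator {0<..<y} t \<partial>lborel"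
  have "(LBINT t=0..ereal y. 1 * H t) = enn2real (\<Sum>N. ennreal (word_coeff n w N) *
       (\<integral>\<^sup>+t. ennreal (1 * sin_monomial N t) * indicator {0<..<y} t \<partial>lborel))"
    by (rule LBINT_word_series[OF _ _ H]) (use assms in auto)
  moreover have tan: "tan y \<ge> 0" using assms tan_gt_zero[of y] by (cases "y = 0") auto
  ultimately have "2 * tan y * (LBINT t=0..ereal y. H t) =
      enn2real (ennreal (2 * tan y) * (\<Sum>N. ennreal (word_coeff n w N) * ?I N))"
    by (simp add: enn2real_mult)
  also have "ennreal (2 * tan y) * (\<Sum>N. ennreal (word_coeff n w N) * ?I N) =
      (\<Sum>m. ennreal (word_coeff n w m) * (ennreal (2 * tan y) * ?I m))"
    by (simp add: mult_ac flip: ennreal_suminf_cmult)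
  also have "\<dots> = (\<Sum>m. \<Sum>N. ennreal (word_coeff n w m) *
      ennreal (if m < N then sin_monomial N y / real N else 0))"
    by (simp only: nn_integral_sin_monomial[OF assms(1,2)] ennreal_suminf_cmult)
  also have "\<dots> = (\<Sum>N. \<Sum>m. ennreal (word_coeff n w m) *
      ennreal (if m < N then sin_monomial N y / real N else 0))"
    by (rule suminf_ennreal_swap)
  also have "\<dots> = (\<Sum>N. ennreal (word_coeff n (1 # w) N * sin_monomial N y))"
  proof (intro arg_cong[where f = suminf] ext)
    fix N
    have "(\<Sum>m. ennreal (word_coeff n w m) * ennreal (if m < N then sin_monomial N y / real N else 0)) =
        (\<Sum>m<N. ennreal (word_coeff n w m) * ennreal (if m < N then sin_monomial N y / real N else 0))"
      by (intro suminf_finite) auto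
    also have "\<dots> = (\<Sum>m<N. ennreal (word_coeff n w m * (sin_monomial N y / real N)))"
      using word_coeff_nonneg sin_monomial_nonneg by (intro sum.cong) (auto simp flip: ennreal_mult)
    also have "\<dots> = ennreal (\<Sum>m<N. word_coeff n w m * (sin_monomial N y / real N))"
      using word_coeff_nonneg sin_monomial_nonneg by (intro sum_ennreal) auto
    also have "(\<Sum>m<N. word_coeff n w m * (sin_monomial N y / real N)) =
        word_coeff n (1 # w) N * sin_monomial N y"
      unfolding sum_distrib_right[symmetric] by simp
    finally show "(\<Sum>m. ennreal (word_coeff n w m) *
        ennreal (if m < N then sin_monomial N y / real N else 0)) =
        ennreal (word_coeff n (1 # w) N * sin_monomial N y)" .
  qed
  finally show ?thesis .
qed

section \<open>Iterated integrals along a word and their parity\<close>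

lemma tan_forms_singleton: "tan_forms [e] g = [g]"
  by (simp add: tan_forms_def)

lemma tan_forms_Cons:
  "tan_forms (e # e' # w) g = (\<lambda>t. tan t powi (int e + int e' - 1)) # tan_forms (e' # w) g"
proof -
  have "[0..<Suc (length w)] = 0 # map Suc [0..<length w]"
    by (simp add: upt_conv_Cons map_Suc_upt del: upt_Suc)
  then show ?thesis by (simp add: tan_forms_def del: upt_Suc)
qed

text \<open>Induction on the word with \<open>y\<close> arbitrary: the hypothesis is used at 0 < t <
  y, where t < pi/2 holds whatever the next letter is.\<close>

lemma iterated_integral_word_series:
  fixes n :: nat
  defines "g \<equiv> \<lambda>t::real. (4 * (sin t)\<^sup>2) ^ n"
  assumes "w \<noteq> []" "set w \<subseteq> {0, 1}" "last w = 1"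
    and "0 \<le> y" "y \<le> pi / 2" "hd w \<noteq> 0 \<Longrightarrow> y < pi / 2"
  shows "2 ^ length w * inverse (real ((2 * n) choose n)) * tan y ^ hd w *
      iterated_integral (tan_forms w g) y =
    enn2real (\<Sum>N. ennreal (word_coeff n w N * sin_monomial N y))"
  using assms(2-)
proof (induction w arbitrary: y)
  case (Cons e w)
  let ?c = "inverse (real ((2 * n) choose n))"
  show ?case
  proof (cases w)
    case Nil
    then have e: "e = 1" and y: "y < pi / 2" using Cons.prems by auto
    have "2 * tan y * (LBINT t=0..ereal y. ?c * g t) =
      enn2real (\<Sum>N. ennreal (word_coeff n (1 # []) N * sin_monomial N y))"
    proof (rule word_series_Cons_1)
      fix t
      have "(\<lambda>N. word_coeff n [] N * sin_monomial N t) = (\<lambda>N. if N = n then sin_monomial N t else 0)"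
        by auto
      then show "?c * g t = (\<Sum>N. word_coeff n [] N * sin_monomial N t)"
        using sums_unique[OF sums_single[of n "\<lambda>N. sin_monomial N t"]]
        by (simp add: sin_monomial_eq g_def)
    qed (use Cons.prems y in auto)
    then show ?thesis using Nil e by (simp add: tan_forms_singleton mult_ac)
  next
    case (Cons e' w')
    define H where "H t = 2 ^ length w * ?c * tan t ^ e' * iterated_integral (tan_forms w g) t" for t
    have H: "H t = (\<Sum>N. word_coeff n w N * sin_monomial N t)" if "0 < t" "t < y" for t
    proof -
      have "H t = enn2real (\<Sum>N. ennreal (word_coeff n w N * sin_monomial N t))"
        using Cons.IH[of t] Cons.prems that Cons by (simp add: H_def)
      \<comment> \<open>Since t < pi/2 the series converges in the reals, so \<open>enn2real\<close>
        recovers its sum.\<close>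
      also have "(\<Sum>N. ennreal (word_coeff n w N * sin_monomial N t)) =
          ennreal (\<Sum>N. word_coeff n w N * sin_monomial N t)"
        using that Cons.prems word_coeff_nonneg sin_monomial_nonneg
        by (intro suminf_ennreal2 summable_word_coeff) auto
      finally show ?thesis
        using that Cons.prems word_coeff_nonneg sin_monomial_nonneg
        by (simp add: suminf_nonneg summable_word_coeff)
    qed
    have "2 ^ length w * ?c * (LBINT t=0..ereal y. tan t powi (int e + int e' - 1) *
        iterated_integral (tan_forms w g) t) =
        (LBINT t=0..ereal y. 2 ^ length w * ?c * (tan t powi (int e + int e' - 1) *
        iterated_integral (tan_forms w g) t))"
      by (simp only: interval_lebesgue_integral_mult_right)
    also have "\<dots> = (LBINT t=0..ereal y. tan t powi (int e - 1) * H t)"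
    proof (rule interval_integral_cong)
      fix t assume "t \<in> einterval (min 0 (ereal y)) (max 0 (ereal y))"
      then have t: "0 < t" "t < y"
        using Cons.prems(4) by (auto simp: einterval_def min_def max_def zero_ereal_def)
      then have "tan t \<noteq> 0" using tan_gt_zero[of t] Cons.prems(5) by simp
      then have "tan t powi (int e + int e' - 1) = tan t powi (int e - 1) * tan t ^ e'"
        using power_int_add[of "tan t" "int e - 1" "int e'"] by (simp add: algebra_simps)
      then show "2 ^ length w * ?c * (tan t powi (int e + int e' - 1) *
        iterated_integral (tan_forms w g) t) = tan t powi (int e - 1) * H t"
        by (simp add: H_def)
    qed
    finally have eq: "2 ^ length (e # w) * ?c * tan y ^ hd (e # w) * iterated_integral (tan_forms (e # w) g) y =
        2 * tan y ^ e * (LBINT t=0..ereal y. tan t powi (int e - 1) * H t)"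
      using Cons by (simp add: tan_forms_Cons mult_ac)
    have "e = 0 \<or> e = 1" using Cons.prems by auto
    then show ?thesis
    proof
      assume "e = 0"
      then show ?thesis unfolding eq
        using word_series_Cons_0[of w y H n] H Cons Cons.prems by simp
    next
      assume "e = 1"
      then show ?thesis unfolding eq
        using word_series_Cons_1[of y H n w] H Cons.prems by simp
    qed
  qed
qed simp

text \<open>Reflecting the integral gives a sign, the outer form has parity e + e' - 1 and the inner
  integral parity e'; the two contributions of e' cancel, leaving parity e. A final letter 1
  corresponds to the odd integral of the even form \<open>g\<close>.\<close>

lemma iterated_integral_tan_forms_minus:
  assumes "w \<noteq> []" "last w = 1" and g: "\<And>t. g (- t) = g t"
  shows "iterated_integral (tan_forms w g) (- y) = (- 1) ^ hd w * iterated_integral (tan_forms w g) y"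
  using assms(1,2)
proof (induction w arbitrary: y)
  case (Cons e w)
  have reflect: "(LBINT t=0..ereal (- y). f t) = - (LBINT t=0..ereal y. f (- t))" for f :: "real \<Rightarrow> real"
    using interval_integral_reflect[of 0 "ereal (- y)" f]
    by (subst interval_integral_endpoints_reverse) simp
  show ?case
  proof (cases w)
    case Nil
    then show ?thesis using Cons.prems g by (simp add: tan_forms_singleton reflect)
  next
    case (Cons e' w')
    have "tan (- t) powi (int e + int e' - 1) * iterated_integral (tan_forms w g) (- t) =
        - ((- 1) ^ e) * (tan t powi (int e + int e' - 1) * iterated_integral (tan_forms w g) t)" for t
    proof -
      have "(- tan t) powi (int e + int e' - 1) = (- 1) powi (int e + int e' - 1) * tan t powi (int e + int e' - 1)"
        using power_int_mult_distrib[of "-1" "tan t"] by simp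
      moreover have sign: "(- 1 :: real) powi (int e + int e' - 1) * (- 1) ^ e' = - ((- 1) ^ e)"
        by (cases "even e'") (simp_all add: power_int_diff power_int_add)
      moreover have "iterated_integral (tan_forms w g) (- t) = (- 1) ^ e' * iterated_integral (tan_forms w g) t"
        using Cons.IH[of t] Cons.prems Cons by simp
      ultimately show ?thesis by (simp flip: sign)
    qed
    then show ?thesis using Cons
      by (simp only: tan_forms_Cons iterated_integral.simps reflect interval_lebesgue_integral_mult_right) simp
  qed
qed simp

section \<open>Nested sums as word series\<close>

text \<open>Without summability both sides are \<open>0\<close>. As the Bochner integral has the same convention,
  convergence at \<open>y = \<plusminus>\<pi>/2\<close> need not be discussed.\<close>

lemma infsum_nonneg_eq_enn2real_suminf:
  fixes f :: "nat \<Rightarrow> real"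
  assumes "\<And>N. 0 \<le> f N"
  shows "infsum f UNIV = enn2real (\<Sum>N. ennreal (f N))"
proof (cases "summable f")
  case True
  then have "f summable_on UNIV" using assms by (simp add: summable_on_UNIV_nonneg_real_iff)
  then have "f sums infsum f UNIV" by (intro has_sum_imp_sums has_sum_infsum)
  then show ?thesis
    using assms by (subst suminf_ennreal_eq) (auto simp: infsum_nonneg)
next
  case False
  then have "\<not> f summable_on UNIV" using assms by (simp add: summable_on_UNIV_nonneg_real_iff)
  moreover have "(\<Sum>N. ennreal (f N)) = top"
    using summable_suminf_not_top[of f] assms False by blast
  ultimately show ?thesis by (simp add: infsum_not_exists)
qed

text \<open>By nonnegativity, summability of the fibre sums forces joint summability. Hence if the
  left side takes its default value 0, so does the right.\<close>

lemma infsum_Sigma_finite_nonneg: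
  fixes f :: "'a \<times> 'b \<Rightarrow> real"
  assumes fin: "\<And>x. x \<in> A \<Longrightarrow> finite (B x)"
    and nonneg: "\<And>x y. x \<in> A \<Longrightarrow> y \<in> B x \<Longrightarrow> 0 \<le> f (x, y)"
  shows "infsum f (Sigma A B) = infsum (\<lambda>x. \<Sum>y\<in>B x. f (x, y)) A"
proof -
  have B: "((\<lambda>y. f (x, y)) has_sum (\<Sum>y\<in>B x. f (x, y))) (B x)" if "x \<in> A" for x
    using fin[OF that] by (rule has_sum_finite)
  show ?thesis
  proof (cases "f summable_on Sigma A B")
    case True
    then have "infsum f (Sigma A B) = infsum (\<lambda>x. infsum (\<lambda>y. f (x, y)) (B x)) A"
      by (rule infsum_Sigma_banach[symmetric])
    also have "\<dots> = infsum (\<lambda>x. \<Sum>y\<in>B x. f (x, y)) A"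
      using B by (intro infsum_cong) (auto intro: infsumI)
    finally show ?thesis .
  next
    case False
    then have "\<not> (\<lambda>x. \<Sum>y\<in>B x. f (x, y)) summable_on A"
      using summable_on_SigmaI[OF B _ nonneg] by blast
    with False show ?thesis by (simp add: infsum_not_exists)
  qed
qed

text \<open>Appending \<open>n\<close> gives the empty tuple the head \<open>n\<close>, which makes the recursion on \<open>r\<close> uniform.\<close>

definition headed_tuples :: "nat \<Rightarrow> nat \<Rightarrow> nat \<Rightarrow> nat list set" where
  "headed_tuples r n N = {ns \<in> decreasing_tuples r n. hd (ns @ [n]) = N}"

lemma headed_tuples_0: "headed_tuples 0 n N = (if N = n then {[]} else {})"
  by (auto simp: headed_tuples_def decreasing_tuples_def)

text \<open>By transitivity a new first entry need only exceed the old head; for the empty tuple the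
  virtual head turns this into n < N.\<close>

lemma headed_tuples_Suc:
  "headed_tuples (Suc r) n N = (#) N ` (\<Union>m<N. headed_tuples r n m)"
proof (intro equalityI subsetI)
  fix ns assume ns: "ns \<in> headed_tuples (Suc r) n N"
  then obtain ms where ms: "ns = N # ms"
    by (cases ns) (auto simp: headed_tuples_def decreasing_tuples_def)
  then have "ms \<in> headed_tuples r n (hd (ms @ [n]))" "hd (ms @ [n]) < N"
    using ns by (cases ms; auto simp: headed_tuples_def decreasing_tuples_def)+
  then show "ns \<in> (#) N ` (\<Union>m<N. headed_tuples r n m)" using ms by blast
next
  fix ns assume "ns \<in> (#) N ` (\<Union>m<N. headed_tuples r n m)"
  then obtain ms where ms: "ns = N # ms" "ms \<in> decreasing_tuples r n" "hd (ms @ [n]) < N"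
    by (auto simp: headed_tuples_def)
  then show "ns \<in> headed_tuples (Suc r) n N"
    by (cases ms) (auto simp: headed_tuples_def decreasing_tuples_def)
qed

lemma finite_headed_tuples: "finite (headed_tuples r n N)"
  by (induction r arbitrary: N) (auto simp: headed_tuples_0 headed_tuples_Suc)

lemma word_coeff_replicate_0:
  "word_coeff n (replicate j 0 @ w) N = word_coeff n w N / real N ^ j"
  by (induction j) (simp_all add: mult.commute)

lemma binary_word_Cons: "binary_word (x # a) = replicate (x - 1) 0 @ 1 # binary_word a"
  by (simp add: binary_word_def)

text \<open>In the block of an entry x, the letter 1 sums over the smaller heads m < N and
  contributes one factor 1/N; the x - 1 zeros contribute the others.\<close>

lemma word_coeff_binary_word:
  assumes "composition a"
  shows "word_coeff n (binary_word a) N =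
    (\<Sum>ns\<in>headed_tuples (length a) n N. \<Prod>i<length a. inverse (real (ns ! i) ^ (a ! i)))"
  using assms
proof (induction a arbitrary: N)
  case Nil
  then show ?case by (simp add: binary_word_def headed_tuples_0)
next
  case (Cons x a)
  let ?P = "\<lambda>a ns. \<Prod>i<length a. inverse (real (ns ! i) ^ (a ! i))"
  have a: "composition a" and x: "x > 0" using Cons.prems by (auto simp: composition_def)
  then obtain j where j: "x = Suc j" by (cases x) auto
  have P: "?P (x # a) (N # ns) = inverse (real N ^ x) * ?P a ns" for ns
    by (simp add: prod.lessThan_Suc_shift del: prod.lessThan_Suc)
  have "(\<Sum>ns\<in>headed_tuples (length (x # a)) n N. ?P (x # a) ns) =
      (\<Sum>ns\<in>(\<Union>m<N. headed_tuples (length a) n m). ?P (x # a) (N # ns))"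
    unfolding list.size(4) headed_tuples_Suc add_0_right add_Suc_right by (subst sum.reindex) (auto simp: inj_on_def)
  also have "\<dots> = inverse (real N ^ x) * (\<Sum>ns\<in>(\<Union>m<N. headed_tuples (length a) n m). ?P a ns)"
    unfolding P by (simp only: sum_distrib_left)
  also have "(\<Sum>ns\<in>(\<Union>m<N. headed_tuples (length a) n m). ?P a ns) =
      (\<Sum>m<N. \<Sum>ns\<in>headed_tuples (length a) n m. ?P a ns)"
    by (rule sum.UNION_disjoint) (auto simp: finite_headed_tuples, auto simp: headed_tuples_def)
  also have "\<dots> = (\<Sum>m<N. word_coeff n (binary_word a) m)"
    using Cons.IH[OF a] by simp
  also have "inverse (real N ^ x) * \<dots> = word_coeff n (binary_word (x # a)) N"
    unfolding binary_word_Cons word_coeff_replicate_0 j by (simp add: field_simps)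
  finally show ?case by simp
qed

text \<open>Tuples are grouped by their head N: the binomial coefficient and the power of z depend
  on N alone and together form \<open>sin_monomial N y\<close>.\<close>

lemma sigma_tail_eq_word_series:
  assumes "composition a" "a \<noteq> []"
  shows "sigma_tail a (4 * (sin y)\<^sup>2) n =
    enn2real (\<Sum>N. ennreal (word_coeff n (binary_word a) N * sin_monomial N y))"
proof -
  let ?P = "\<lambda>ns. \<Prod>i<length a. inverse (real (ns ! i) ^ (a ! i))"
  let ?S = "Sigma UNIV (headed_tuples (length a) n)"
  have "bij_betw snd ?S (decreasing_tuples (length a) n)"
    by (intro bij_betwI[where g = "\<lambda>ns. (hd (ns @ [n]), ns)"]) (auto simp: headed_tuples_def)
  then have "sigma_tail a (4 * (sin y)\<^sup>2) n = (\<Sum>\<^sub>\<infinity>p\<in>?S. sigma_term a (4 * (sin y)\<^sup>2) (snd p))"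
    unfolding sigma_tail_def by (rule infsum_reindex_bij_betw[symmetric])
  also have "\<dots> = (\<Sum>\<^sub>\<infinity>(N, ns)\<in>?S. sin_monomial N y * ?P ns)"
  proof (rule infsum_cong)
    fix p assume p: "p \<in> ?S"
    then have "hd (snd p) = fst p" using assms(2)
      by (cases "snd p") (auto simp: headed_tuples_def decreasing_tuples_def)
    then show "sigma_term a (4 * (sin y)\<^sup>2) (snd p) = (case p of (N, ns) \<Rightarrow> sin_monomial N y * ?P ns)"
      by (cases p) (simp add: sigma_term_def sin_monomial_eq mult_ac)
  qed
  also have "\<dots> = (\<Sum>\<^sub>\<infinity>N\<in>UNIV. \<Sum>ns\<in>headed_tuples (length a) n N. sin_monomial N y * ?P ns)"
    by (subst infsum_Sigma_finite_nonneg)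
      (auto simp: finite_headed_tuples intro!: mult_nonneg_nonneg sin_monomial_nonneg prod_nonneg)
  also have "\<dots> = (\<Sum>\<^sub>\<infinity>N\<in>UNIV. word_coeff n (binary_word a) N * sin_monomial N y)"
    by (simp only: word_coeff_binary_word[OF assms(1)] sum_distrib_left mult.commute)
  also have "\<dots> = enn2real (\<Sum>N. ennreal (word_coeff n (binary_word a) N * sin_monomial N y))"
    by (intro infsum_nonneg_eq_enn2real_suminf mult_nonneg_nonneg word_coeff_nonneg sin_monomial_nonneg)
  finally show ?thesis .
qed

section \<open>Both signs of y and the endpoints\<close>

lemma binary_word_properties:
  assumes "a \<noteq> []"
  shows "binary_word a \<noteq> []" "set (binary_word a) \<subseteq> {0, 1}" "last (binary_word a) = 1"
proof -
  show "binary_word a \<noteq> []" using assms by (cases a) (auto simp: binary_word_Cons)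
  show "set (binary_word a) \<subseteq> {0, 1}" by (auto simp: binary_word_def)
  show "last (binary_word a) = 1"
    using assms by (induction a) (auto simp: binary_word_Cons binary_word_def)
qed

lemma sigma_tail_eq_iterated_integral:
  assumes "composition a" "a \<noteq> []"
    and y: "\<bar>y\<bar> \<le> pi / 2" "hd (binary_word a) \<noteq> 0 \<Longrightarrow> \<bar>y\<bar> < pi / 2"
  shows "sigma_tail a (4 * (sin y)\<^sup>2) n =
    2 ^ length (binary_word a) * inverse (real ((2 * n) choose n)) * tan y ^ hd (binary_word a) *
    iterated_integral (tan_forms (binary_word a) (\<lambda>t. (4 * (sin t)\<^sup>2) ^ n)) y"
    (is "?L y = ?R y")
proof -
  have pos: "?L y = ?R y" if "0 \<le> y" "y \<le> pi / 2" "hd (binary_word a) \<noteq> 0 \<Longrightarrow> y < pi / 2" for y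
    using iterated_integral_word_series[OF binary_word_properties[OF assms(2)], of y n]
      sigma_tail_eq_word_series[OF assms(1,2), of y n] that by simp
  \<comment> \<open>The power of tan y and the iterated integral have the same parity, so their
    product is even, like the left side, which sees only the square of sin y.\<close>
  have even: "?R (- y) = ?R y"
  proof -
    have "(- tan y) ^ j * (- 1) ^ j = tan y ^ j" for j by (simp flip: power_mult_distrib)
    then show ?thesis
      using binary_word_properties[OF assms(2)] by (simp add: iterated_integral_tan_forms_minus)
  qed
  show ?thesis
  proof (cases "0 \<le> y")
    case True
    then show ?thesis using pos[of y] y by simp
  next
    case False
    then have "?L (- y) = ?R (- y)" using y by (intro pos) auto
    then show ?thesis unfolding even by simp
  qed
qed

theorem theorem4:
  fixes a \<epsilon> :: "nat list" and k :: nat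
  assumes "composition a" and "a \<noteq> []"
    and "\<epsilon> = binary_word a" and "k = length \<epsilon>"
  shows "(\<forall>y\<in>{-(pi/2)<..<pi/2}.
            sigma_series a (4 * (sin y)\<^sup>2) =
              2 ^ k * tan y ^ hd \<epsilon> * iterated_integral (tan_forms \<epsilon> (\<lambda>t. 1)) y)
       \<and> (\<forall>n. \<forall>y\<in>{-(pi/2)<..<pi/2}.
            sigma_tail a (4 * (sin y)\<^sup>2) n =
              2 ^ k * inverse (real ((2 * n) choose n)) * tan y ^ hd \<epsilon> *
              iterated_integral (tan_forms \<epsilon> (\<lambda>t. (4 * (sin t)\<^sup>2) ^ n)) y)
       \<and> (admissible a \<longrightarrow>
            (\<forall>y\<in>{-(pi/2)..pi/2}.
               sigma_series a (4 * (sin y)\<^sup>2) =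
                 2 ^ k * tan y ^ hd \<epsilon> * iterated_integral (tan_forms \<epsilon> (\<lambda>t. 1)) y)
          \<and> (\<forall>n. \<forall>y\<in>{-(pi/2)..pi/2}.
               sigma_tail a (4 * (sin y)\<^sup>2) n =
                 2 ^ k * inverse (real ((2 * n) choose n)) * tan y ^ hd \<epsilon> *
                 iterated_integral (tan_forms \<epsilon> (\<lambda>t. (4 * (sin t)\<^sup>2) ^ n)) y))"
proof -
  have tail: "sigma_tail a (4 * (sin y)\<^sup>2) n =
      2 ^ k * inverse (real ((2 * n) choose n)) * tan y ^ hd \<epsilon> *
      iterated_integral (tan_forms \<epsilon> (\<lambda>t. (4 * (sin t)\<^sup>2) ^ n)) y"
    if "\<bar>y\<bar> \<le> pi / 2" "hd \<epsilon> \<noteq> 0 \<Longrightarrow> \<bar>y\<bar> < pi / 2" for n y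
    using sigma_tail_eq_iterated_integral[OF assms(1,2)] that unfolding assms(3,4) by blast
  have series: "sigma_series a (4 * (sin y)\<^sup>2) =
      2 ^ k * tan y ^ hd \<epsilon> * iterated_integral (tan_forms \<epsilon> (\<lambda>t. 1)) y"
    if "\<bar>y\<bar> \<le> pi / 2" "hd \<epsilon> \<noteq> 0 \<Longrightarrow> \<bar>y\<bar> < pi / 2" for y
    \<comment> \<open>For n = 0 the binomial coefficient is 1 and the last form is constant
      1.\<close>
    using tail[OF that, of 0] by (simp add: sigma_series_def sigma_tail_def)
  \<comment> \<open>With first letter 0 the prefactor is tan y ^ 0 = 1, and \<open>tail\<close> and
    \<open>series\<close> apply at the endpoints too.\<close>
  have "hd \<epsilon> = 0" if "admissible a"
  proof -
    obtain x b where a: "a = x # b" using assms(2) by (cases a) auto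
    then have "2 \<le> x" using that by (simp add: admissible_def)
    then show ?thesis using a assms(3) by (cases "x - 1") (auto simp: binary_word_Cons)
  qed
  then show ?thesis
    by (intro conjI allI ballI impI series tail) (auto simp: abs_if)
qed

end
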